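(* Let $f(x), g(x) \in \mathbb{F}_q[x]$ be nonconstant polynomials such that $f(x)-g(y)\notin \mathbb{F}_q[x^p,y^p]$. Suppose that the irreducible components of the curve $\mathcal{F}: f(x)=g(y)$ are defined over $\mathbb{F}_q$. If the irreducible components of $\mathcal{F}$ are $q$-Frobenius nonclassical, then $f$ and $g$ are minimal value set polynomials over $\mathbb{F}_q$ with $V_f=V_g$. Conversely, suppose that $f$ and $g$ are minimal value set polynomials over $\mathbb{F}_q$ with $V_f=V_g$. If $|V_f|>2$ or $|V_f|=2=p$, then the irreducible components of $\mathcal{F}$ are $q$-Frobenius nonclassical.
   Context: $p$ is a prime and $q$ is a power of $p$; $\overline{\mathbb{F}_q}$ is the algebraic closure of $\mathbb{F}_q$. For a nonconstant $F\in\mathbb{F}_q[x]$, $V_F=\{F(\alpha):\alpha\in\mathbb{F}_q\}$ is its value set; it always satisfies $\lfloor (q-1)/\deg F\rfloor+1\le |V_F|\le q$, and $F$ is called a minimal value set polynomial (MVSP) if $|V_F|=\lfloor (q-1)/\deg F\rfloor+1$. The irreducible components of a plane curve $G(x,y)=0$ are the curves $G_i=0$, where the $G_i$ are the irreducible factors of $G$ in $\overline{\mathbb{F}_q}[x,y]$; a component is defined over $\mathbb{F}_q$ if, up to a nonzero constant, $G_i\in\mathbb{F}_q[x,y]$. An (absolutely) irreducible plane curve $F(x,y)=0$ with $F\in\mathbb{F}_q[x,y]$ is called $q$-Frobenius nonclassical if $F$ divides $(x^q-x)\frac{\partial F}{\partial x}+(y^q-y)\frac{\partial F}{\partial y}$.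 *)

theory Defs
  imports "HOL-Library.Cardinality" "HOL-Algebra.Algebraic_Closure_Type"
begin

definition value_set :: "'a::comm_semiring_0 poly \<Rightarrow> 'a set" where
  "value_set F = range (poly F)"

(* In the next definition, div is the floor of the quotient. *)

definition min_value_set_poly :: "'a::finite_field poly \<Rightarrow> bool" where
  "min_value_set_poly F \<longleftrightarrow>
     degree F > 0 \<and> card (value_set F) = (CARD('a) - 1) div degree F + 1"

(* An element of K[x,y] is represented as an element of (K[x])[y], i.e. of type
   'a poly poly: the outer indeterminate is y, the inner one is x. *)

definition var_x :: "'a::comm_semiring_1 poly poly" where
  "var_x = [:[:0, 1:]:]"

definition var_y :: "'a::comm_semiring_1 poly poly" where
  "var_y = [:0, 1:]"

definition in_x :: "'a::zero poly \<Rightarrow> 'a poly poly" where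
  "in_x f = [:f:]"

definition in_y :: "'a::zero poly \<Rightarrow> 'a poly poly" where
  "in_y g = map_poly (\<lambda>c. [:c:]) g"

definition partial_x :: "'a::idom poly poly \<Rightarrow> 'a poly poly" where
  "partial_x F = map_poly pderiv F"

definition partial_y :: "'a::idom poly poly \<Rightarrow> 'a poly poly" where
  "partial_y F = pderiv F"

(* H(x,y) is sent to H(x^n,y^n); the range of this map is the subring K[x^n,y^n]. *)

definition subst_powers :: "nat \<Rightarrow> 'a::comm_ring_1 poly poly \<Rightarrow> 'a poly poly" where
  "subst_powers n H = pcompose (map_poly (\<lambda>c. pcompose c (monom 1 n)) H) (monom 1 n)"

definition polys_in_powers :: "nat \<Rightarrow> 'a::comm_ring_1 poly poly set" where
  "polys_in_powers n = range (subst_powers n)"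

definition to_closure :: "'a::field poly poly \<Rightarrow> 'a alg_closure poly poly" where
  "to_closure F = map_poly (map_poly to_ac) F"

(* A component is represented by any of its equations; these differ by nonzero constants. *)

definition irreducible_component ::
    "'a::field poly poly \<Rightarrow> 'a alg_closure poly poly \<Rightarrow> bool" where
  "irreducible_component H G \<longleftrightarrow> irreducible G \<and> G dvd to_closure H"

definition base_field_equation ::
    "'a::field poly poly \<Rightarrow> 'a alg_closure poly poly \<Rightarrow> bool" where
  "base_field_equation F G \<longleftrightarrow> (\<exists>c. c \<noteq> 0 \<and> to_closure F = smult [:c:] G)"

definition defined_over_base_field :: "'a::field alg_closure poly poly \<Rightarrow> bool" where
  "defined_over_base_field G \<longleftrightarrow> (\<exists>F. base_field_equation F G)"

definition frobenius_nonclassical :: "'a::finite_field poly poly \<Rightarrow> bool" where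
  "frobenius_nonclassical F \<longleftrightarrow>
     irreducible (to_closure F) \<and>
     F dvd (var_x ^ CARD('a) - var_x) * partial_x F + (var_y ^ CARD('a) - var_y) * partial_y F"

(* The notion only makes sense for a component defined over the base field, and does not
   depend on the equation F over the base field that is chosen for it. *)

definition frobenius_nonclassical_component :: "'a::finite_field alg_closure poly poly \<Rightarrow> bool" where
  "frobenius_nonclassical_component G \<longleftrightarrow>
     (\<exists>F. base_field_equation F G \<and> frobenius_nonclassical F)"

end

(* Write q for the order of the field and D for the derivation A |-> (x^q - x) A_x + (y^q - y) A_y.

   If all irreducible factors of H = f(x) - g(y) divide their image under D, then H divides
   D H = (x^q - x) f'(x) - (y^q - y) g'(y).  Expanding (y^q - y) g'(y) in base g(y) and reducing
   modulo H gives a single polynomial T with (x^q - x) f' = T(f) and (y^q - y) g' = T(g).  Its degree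
   is at most (q - 1) div deg f + 1, and all values of f are roots of it; as f has at least that many
   values, f is an MVSP whose value set is the set of roots of T.  The same holds for g.

   Conversely, let f be an MVSP with value set V and write f - c = P_c Q_c with P_c the product of
   the x - a over the a in the field with f(a) = c.  Put h = prod_{c in V} Q_c, of degree < deg f, and
   t_c = prod_{e in V, e ~= c} (c - e).  Comparing values at the roots of P_c gives
   t_c P_c' Q_c = - h, that is, f' + h / t_c = P_c Q_c'.  Comparing these identities for two or
   three values shows Q_c' = 0, hence f' = - h / t_c, for all but at most one c in V (for all c if
   card V = p = 2).  As prod_{c in V} (f - c) = (x^q - x) h, this gives
   (x^q - x) f' = - (1 / t_c) prod_{c in V} (f - c).  The same holds for g, with the same constant, so
   H divides D H.  Since f' ~= 0, H is squarefree, so each of its irreducible factors G divides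
   D G.  *)

theory Submission
  imports Defs
begin

section \<open>Minimal value set polynomials\<close>

lemma prod_linear_factors_dvd:
  fixes p :: "'a::idom poly"
  assumes "finite A" "\<And>a. a \<in> A \<Longrightarrow> poly p a = 0"
  shows "(\<Prod>a\<in>A. [:- a, 1:]) dvd p"
  using assms
proof (induction A arbitrary: p rule: finite_induct)
  case (insert a A)
  from insert.prems have "[:- a, 1:] dvd p"
    by (simp add: poly_eq_0_iff_dvd)
  then obtain r where r: "p = [:- a, 1:] * r"
    by (rule dvdE)
  have "poly r b = 0" if "b \<in> A" for b
    using insert.prems[of b] insert.hyps that by (auto simp: r)
  then have "(\<Prod>a\<in>A. [:- a, 1:]) dvd r"
    by (rule insert.IH)
  then show ?case
    unfolding prod.insert[OF insert.hyps] r by (rule mult_dvd_mono[OF dvd_refl])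
qed simp

lemma degree_prod_linear_factors:
  "degree (\<Prod>a\<in>A. [:- a, 1::'a::idom:]) = card A"
  by (subst degree_prod_sum_eq) auto

lemma degree_pderiv_less: "degree p > 0 \<Longrightarrow> degree (pderiv p) < degree p"
  for p :: "'a::idom poly"
proof -
  assume "degree p > 0"
  moreover have "degree (pderiv p) \<le> degree p - 1"
    by (rule degree_le) (simp add: coeff_pderiv coeff_eq_0)
  ultimately show ?thesis by linarith
qed

lemma pderiv_eq_0_if_dvd: "p dvd pderiv p \<Longrightarrow> pderiv p = 0"
  for p :: "'a::idom poly"
  by (metis degree_eq_zeroE degree_pderiv_less dvd_imp_degree_le gr0I not_le pderiv_singleton)

lemma one_less_CARD: "1 < CARD('a::finite_field)"
proof -
  have "card {0, 1::'a} \<le> CARD('a)"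
    by (intro card_mono) auto
  then show ?thesis by simp
qed

text \<open>Translation by 1 permutes the field, so the sums of \<open>x + 1\<close> and of
  \<open>x\<close> over it agree; they differ by \<open>CARD('a)\<close> copies of 1.\<close>

lemma of_nat_CARD_eq_0: "of_nat CARD('a) = (0::'a::finite_field)"
proof -
  have "(\<Sum>x\<in>UNIV. x + 1) = (\<Sum>x\<in>UNIV. x::'a)"
    by (rule sum.reindex_bij_witness[of _ "\<lambda>x. x - 1" "\<lambda>x. x + 1"]) auto
  then show ?thesis
    by (simp add: sum.distrib)
qed

text \<open>Both sides are monic of degree q and vanish at all q elements of the field, so their
  difference has too many roots for its degree.\<close>

lemma prod_all_linear_factors:
  "(\<Prod>a\<in>UNIV. [:- a, 1:]) = monom 1 CARD('a) - monom (1::'a::finite_field) 1"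
proof (rule poly_eqI_degree_lead_coeff[where A = UNIV and n = "CARD('a)"])
  let ?p = "\<Prod>a\<in>UNIV. [:- a, 1::'a:]"
  have deg: "degree ?p = CARD('a)"
    by (rule degree_prod_linear_factors)
  have "lead_coeff ?p = 1"
    by (simp add: lead_coeff_prod)
  then show "coeff ?p CARD('a) = coeff (monom 1 CARD('a) - monom 1 1) CARD('a)"
    using one_less_CARD[where 'a = 'a] unfolding deg by simp
  show "degree ?p \<le> CARD('a)" by (simp add: deg)
  show "degree (monom 1 CARD('a) - monom (1::'a) 1) \<le> CARD('a)"
    using one_less_CARD[where 'a = 'a]
    by (intro degree_diff_le degree_monom_le order.trans[OF degree_monom_le]) auto
  show "poly ?p z = poly (monom 1 CARD('a) - monom 1 1) z" for z
    using finite_field_power_card_eq_same[of z] by (simp add: poly_prod poly_monom)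
qed simp

text \<open>Each fiber of \<open>f\<close> has at most \<open>degree f\<close> elements, and the
  fibers over the value set cover the field.\<close>

lemma value_set_lower_bound:
  fixes f :: "'a::finite_field poly"
  assumes "degree f > 0"
  shows "(CARD('a) - 1) div degree f + 1 \<le> card (value_set f)"
proof -
  have "card {a. poly f a = c} \<le> degree f" for c
  proof -
    have "f - [:c:] \<noteq> 0"
      using assms by (metis degree_pCons_0 eq_iff_diff_eq_0 less_numeral_extra(3))
    then have "card {a. poly (f - [:c:]) a = 0} \<le> degree (f - [:c:])"
      by (rule card_poly_roots_bound)
    also have "\<dots> \<le> degree f"
      by (rule degree_diff_le) auto
    finally show ?thesis by simp
  qed
  then have "card (\<Union>c\<in>value_set f. {a. poly f a = c}) \<le> (\<Sum>c\<in>value_set f. degree f)"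
    by (intro order.trans[OF card_UN_le] sum_mono) auto
  also have "(\<Union>c\<in>value_set f. {a. poly f a = c}) = UNIV"
    by (auto simp: value_set_def)
  finally have "CARD('a) \<le> card (value_set f) * degree f" by simp
  \<comment> \<open>The step from q - 1 to q makes the resulting inequality strict, which accounts
    for the \<open>+ 1\<close>.\<close>
  moreover have "(CARD('a) - 1) div degree f * degree f \<le> CARD('a) - 1"
    by simp
  ultimately have "(CARD('a) - 1) div degree f * degree f < card (value_set f) * degree f"
    using one_less_CARD[where 'a = 'a] by linarith
  then show ?thesis by simp
qed

section \<open>The factorizations of \<open>f - [:c:]\<close> for a minimal value set
  polynomial\<close>

locale min_value_set =
  fixes f :: "'a::finite_field poly"
  assumes mvsp: "min_value_set_poly f"
begin

abbreviation V where "V \<equiv> value_set f"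

definition fiber :: "'a \<Rightarrow> 'a set" where
  "fiber c = {a. poly f a = c}"

definition P :: "'a \<Rightarrow> 'a poly" where
  "P c = (\<Prod>a\<in>fiber c. [:- a, 1:])"

text \<open>The division is exact, since \<open>P c\<close> is a product over distinct roots of
  \<open>f - [:c:]\<close>; excess multiplicities and factors without roots in the field
  remain.\<close>

definition Q :: "'a \<Rightarrow> 'a poly" where
  "Q c = (f - [:c:]) div P c"

definition cofactor :: "'a poly" where
  "cofactor = (\<Prod>c\<in>V. Q c)"

text \<open>For \<open>c\<close> in \<open>V\<close> this is the derivative at \<open>c\<close> of
  the monic polynomial with simple roots exactly at \<open>V\<close>.\<close>

definition gap :: "'a \<Rightarrow> 'a" where
  "gap c = (\<Prod>e\<in>V - {c}. c - e)"

lemma degree_pos: "degree f > 0"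
  using mvsp by (simp add: min_value_set_poly_def)

lemma gap_nonzero: "gap c \<noteq> 0"
  by (simp add: gap_def)

lemma degree_diff_const: "degree (f - [:c:]) = degree f"
  using degree_pos by (metis degree_pCons_0 degree_add_eq_left diff_conv_add_uminus degree_minus)

lemma factorization: "f - [:c:] = P c * Q c"
proof -
  have "P c dvd f - [:c:]"
    unfolding P_def by (rule prod_linear_factors_dvd) (auto simp: fiber_def)
  then show ?thesis by (simp add: Q_def)
qed

lemma diff_const_nonzero: "f - [:c:] \<noteq> 0"
  using degree_diff_const[of c] degree_pos by auto

lemma P_nonzero: "P c \<noteq> 0" and Q_nonzero: "Q c \<noteq> 0"
  using factorization[of c] diff_const_nonzero[of c] by auto

lemma degree_P: "degree (P c) = card (fiber c)"
  unfolding P_def by (rule degree_prod_linear_factors)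

lemma poly_P_eq_0_iff: "poly (P c) a = 0 \<longleftrightarrow> poly f a = c"
  by (auto simp: P_def poly_prod fiber_def)

lemma degree_P_Q: "degree (P c) + degree (Q c) = degree f"
  by (metis degree_diff_const factorization degree_mult_eq P_nonzero Q_nonzero)

lemma prod_P: "(\<Prod>c\<in>V. P c) = monom 1 CARD('a) - monom 1 1"
proof -
  have "(\<Prod>a\<in>UNIV. [:- a, 1:]) = (\<Prod>c\<in>V. \<Prod>a\<in>{a\<in>UNIV. poly f a = c}. [:- a, 1:])"
    by (rule prod.group[symmetric]) (auto simp: value_set_def)
  then show ?thesis
    by (simp add: P_def fiber_def prod_all_linear_factors)
qed

lemma pderiv_prod_P: "pderiv (\<Prod>c\<in>V. P c) = - 1"
  by (simp add: prod_P pderiv_diff pderiv_monom of_nat_CARD_eq_0 one_pCons monom_0)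

lemma prod_diff_const: "(\<Prod>c\<in>V. f - [:c:]) = (monom 1 CARD('a) - monom 1 1) * cofactor"
  by (simp add: factorization prod.distrib prod_P cofactor_def)

text \<open>Minimality of the value set enters here: the degrees of the factors give
  \<open>degree f * card V\<close> = q + \<open>degree cofactor\<close>, while minimality bounds the
  left side by q - 1 + \<open>degree f\<close>.\<close>

lemma degree_cofactor: "degree cofactor < degree f"
proof -
  have "degree f * card V = (\<Sum>c\<in>V. degree (P c) + degree (Q c))"
    by (simp add: degree_P_Q)
  also have "\<dots> = degree (\<Prod>c\<in>V. P c) + degree cofactor"
    unfolding cofactor_def by (simp add: sum.distrib degree_prod_sum_eq P_nonzero Q_nonzero)
  also have "degree (\<Prod>c\<in>V. P c) = CARD('a)"
    unfolding prod_P prod_all_linear_factors[symmetric] by (rule degree_prod_linear_factors)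
  finally have "CARD('a) + degree cofactor = degree f * ((CARD('a) - 1) div degree f) + degree f"
    using mvsp by (simp add: min_value_set_poly_def)
  moreover have "degree f * ((CARD('a) - 1) div degree f) \<le> CARD('a) - 1"
    by simp
  ultimately show ?thesis
    using one_less_CARD[where 'a = 'a] by linarith
qed

lemma cofactor_nonzero: "cofactor \<noteq> 0"
  by (simp add: cofactor_def Q_nonzero)

lemma cofactor_remove: "c \<in> V \<Longrightarrow> cofactor = Q c * (\<Prod>e\<in>V - {c}. Q e)"
  unfolding cofactor_def by (rule prod.remove) auto

text \<open>Both sides have degree less than the number of roots of \<open>P c\<close>, so it suffices to
  compare them at these roots, using that \<open>\<Prod>c\<in>V. P c\<close> has derivative \<open>-1\<close>.\<close>
lemma gap_pderiv_P:
  assumes c: "c \<in> V"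
  shows "smult (gap c) (pderiv (P c)) = - (\<Prod>e\<in>V - {c}. Q e)"
proof (rule poly_eqI_degree[where A = "fiber c"])
  let ?R = "\<Prod>e\<in>V - {c}. P e" and ?S = "\<Prod>e\<in>V - {c}. Q e"
  fix a assume a: "a \<in> fiber c"
  have "(\<Prod>e\<in>V. P e) = P c * ?R"
    using c by (intro prod.remove) auto
  then have "pderiv (P c * ?R) = - 1"
    using pderiv_prod_P by simp
  then have "poly (pderiv (P c * ?R)) a = - 1"
    by simp
  then have R: "poly ?R a * poly (pderiv (P c)) a = - 1"
    using a poly_P_eq_0_iff[of c a] by (simp add: pderiv_mult fiber_def)
  have "?R * ?S = (\<Prod>e\<in>V - {c}. f - [:e:])"
    by (simp add: factorization prod.distrib)
  then have "poly (?R * ?S) a = gap c"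
    using a by (simp add: poly_prod gap_def fiber_def)
  then have "gap c * poly (pderiv (P c)) a = poly ?S a * (poly ?R a * poly (pderiv (P c)) a)"
    by (simp add: mult_ac)
  then show "poly (smult (gap c) (pderiv (P c))) a = poly (- ?S) a"
    by (simp add: R)
next
  have "card (fiber c) > 0"
    using c by (auto simp: card_gt_0_iff fiber_def value_set_def)
  then show "degree (smult (gap c) (pderiv (P c))) < card (fiber c)"
    using degree_pderiv_less[of "P c"] gap_nonzero by (simp add: degree_P)
  have "degree (Q c) + degree (\<Prod>e\<in>V - {c}. Q e) = degree cofactor"
    unfolding cofactor_remove[OF c] by (subst degree_mult_eq) (auto simp: Q_nonzero)
  then show "degree (- (\<Prod>e\<in>V - {c}. Q e)) < card (fiber c)"
    using degree_cofactor degree_P_Q[of c] by (simp add: degree_P)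
qed

text \<open>Multiplying \<open>gap_pderiv_P\<close> by \<open>Q c\<close> turns
  \<open>Q c * pderiv (P c)\<close> into a constant multiple of \<open>cofactor\<close>; the product
  rule for \<open>P c * Q c\<close> does the rest.\<close>

lemma pderiv_plus_cofactor:
  assumes c: "c \<in> V"
  shows "pderiv f + smult (inverse (gap c)) cofactor = P c * pderiv (Q c)"
proof -
  have "smult (gap c) (Q c * pderiv (P c)) = - cofactor"
    unfolding cofactor_remove[OF c] using gap_pderiv_P[OF c]
    by (metis mult_minus_right mult_smult_right)
  then have *: "Q c * pderiv (P c) = - smult (inverse (gap c)) cofactor"
    using gap_nonzero[of c]
    by (metis smult_minus_right smult_smult left_inverse smult_1_left)
  have "pderiv f = pderiv (f - [:c:])"
    by (simp add: pderiv_diff)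
  also have "\<dots> = P c * pderiv (Q c) + Q c * pderiv (P c)"
    by (simp only: factorization pderiv_mult)
  finally show ?thesis by (simp add: *)
qed

section \<open>Vanishing of the derivative of \<open>Q c\<close>\<close>

lemma degree_Q_add: 
  assumes "c \<in> V" "e \<in> V" "c \<noteq> e"
  shows "degree (Q c) + degree (Q e) < degree f"
proof -
  have "(\<Sum>x\<in>{c, e}. degree (Q x)) \<le> (\<Sum>x\<in>V. degree (Q x))"
    using assms by (intro sum_mono2) auto
  also have "\<dots> = degree cofactor"
    unfolding cofactor_def by (simp add: degree_prod_sum_eq Q_nonzero)
  finally show ?thesis
    using assms degree_cofactor by simp
qed

text \<open>Equal gaps give \<open>P c * pderiv (Q c) = P e * pderiv (Q e)\<close>. The right side
  vanishes on \<open>fiber e\<close>, where \<open>P c\<close> has no zero, and this fiber has more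
  elements than the degree of \<open>Q c\<close>.\<close>

lemma pderiv_Q_eq_0_if_gap_eq:
  assumes "c \<in> V" "e \<in> V" "c \<noteq> e" "gap c = gap e"
  shows "pderiv (Q c) = 0"
proof (rule poly_eqI_degree[where A = "fiber e"])
  have eq: "P c * pderiv (Q c) = P e * pderiv (Q e)"
    using assms pderiv_plus_cofactor by metis
  show "poly (pderiv (Q c)) a = poly 0 a" if "a \<in> fiber e" for a
  proof -
    have "poly (P c) a * poly (pderiv (Q c)) a = 0"
      using arg_cong[OF eq, of "\<lambda>p. poly p a"] that poly_P_eq_0_iff[of e a]
      by (simp add: fiber_def)
    then show ?thesis
      using that assms(3) by (auto simp: poly_P_eq_0_iff fiber_def)
  qed
  have "degree (Q c) < card (fiber e)"
    using degree_Q_add[OF assms(1-3)] degree_P_Q[of e] by (simp add: degree_P)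
  moreover have "degree (pderiv (Q c)) \<le> degree (Q c)"
    by (rule degree_le) (simp add: coeff_pderiv coeff_eq_0)
  ultimately show "degree (pderiv (Q c)) < card (fiber e)" "degree (0::'a poly) < card (fiber e)"
    by auto
qed

text \<open>\<open>Q c\<close> and \<open>Q e\<close> are coprime, because they divide
  \<open>f - [:c:]\<close> and \<open>f - [:e:]\<close>, whose difference is a nonzero
  constant.\<close>

lemma Q_dvd_cancel:
  assumes "Q c dvd Q e * r" "c \<noteq> e"
  shows "Q c dvd r"
proof -
  have "[:e - c:] * r = (f - [:c:]) * r - (f - [:e:]) * r"
    by (simp flip: left_diff_distrib)
  also have "\<dots> = Q c * (P c * r) - P e * (Q e * r)"
    unfolding factorization by (simp only: mult_ac)
  finally have "[:e - c:] * r = Q c * (P c * r) - P e * (Q e * r)" .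
  moreover have "Q c dvd P e * (Q e * r)"
    using assms(1) by (rule dvd_mult)
  ultimately have "Q c dvd [:e - c:] * r"
    by (metis dvd_diff dvd_triv_left)
  then show ?thesis
    using assms(2) by (simp add: dvd_smult_iff)
qed

text \<open>The combination of the identities of \<open>pderiv_plus_cofactor\<close> for \<open>i\<close>, \<open>j\<close>, \<open>k\<close>
  that eliminates the left-hand sides has the form \<open>f * X = Y\<close> with \<open>X\<close> and \<open>Y\<close> of degree
  less than that of \<open>f\<close>, so that \<open>X = 0\<close>.\<close>
lemma pderiv_Q_eq_0_if_gap_neq:
  assumes V: "i \<in> V" "j \<in> V" "k \<in> V" and neq: "i \<noteq> j" "i \<noteq> k" "j \<noteq> k"
    and gap: "gap j \<noteq> gap k"
  shows "pderiv (Q i) = 0"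
proof -
  define s where "s c = [:inverse (gap c):]" for c
  have s: "P c * pderiv (Q c) = pderiv f + s c * cofactor" if "c \<in> V" for c
    using pderiv_plus_cofactor[OF that] by (simp add: s_def)
  \<comment> \<open>The three cyclic differences of the \<open>s c\<close> sum to zero, and so do
    their products with \<open>s i\<close>, \<open>s j\<close>, \<open>s k\<close> respectively;
    hence both \<open>pderiv f\<close> and \<open>cofactor\<close> cancel.\<close>
  define A where "A = (s j - s k) * (pderiv (Q i) * Q j * Q k)"
  define B where "B = (s k - s i) * (Q i * pderiv (Q j) * Q k)"
  define C where "C = (s i - s j) * (Q i * Q j * pderiv (Q k))"
  have "(f - [:i:]) * A + (f - [:j:]) * B + (f - [:k:]) * C
      = Q i * Q j * Q k * ((s j - s k) * (P i * pderiv (Q i)) + (s k - s i) * (P j * pderiv (Q j))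
          + (s i - s j) * (P k * pderiv (Q k)))"
    unfolding factorization A_def B_def C_def by (simp add: algebra_simps)
  also have "\<dots> = 0"
    unfolding s[OF V(1)] s[OF V(2)] s[OF V(3)] by (simp add: algebra_simps)
  finally have fX: "f * (A + B + C) = [:i:] * A + [:j:] * B + [:k:] * C"
    by (simp add: algebra_simps)
  have "(\<Sum>x\<in>{i, j, k}. degree (Q x)) \<le> (\<Sum>x\<in>V. degree (Q x))"
    using V by (intro sum_mono2) auto
  also have "\<dots> = degree cofactor"
    unfolding cofactor_def by (simp add: degree_prod_sum_eq Q_nonzero)
  finally have sum: "degree (Q i) + degree (Q j) + degree (Q k) < degree f"
    using neq degree_cofactor by simp
  have der: "degree (pderiv (Q c)) \<le> degree (Q c)" for c
    by (rule degree_le) (simp add: coeff_pderiv coeff_eq_0)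
  have deg: "degree ([:u:] * (v * p * q * r)) \<le> degree v + degree p + degree q + degree r"
    for u and v p q r :: "'a poly"
    using degree_smult_le[of u "v * p * q * r"] degree_mult_le[of "v * p * q" r]
      degree_mult_le[of "v * p" q] degree_mult_le[of v p] by simp
  have sdeg: "degree (s c - s e) = 0" for c e by (simp add: s_def)
  have ABC: "degree ([:u:] * A) < degree f" "degree ([:u:] * B) < degree f"
    "degree ([:u:] * C) < degree f" for u
    using sum der[of i] der[of j] der[of k] sdeg
      deg[of u "s j - s k" "pderiv (Q i)" "Q j" "Q k"]
      deg[of u "s k - s i" "Q i" "pderiv (Q j)" "Q k"]
      deg[of u "s i - s j" "Q i" "Q j" "pderiv (Q k)"]
    by (auto simp: A_def B_def C_def mult.assoc)
  then have "degree (f * (A + B + C)) < degree f"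
    unfolding fX by (intro degree_add_less)
  then have "A + B + C = 0"
    using degree_mult_eq[of f "A + B + C"] degree_pos by fastforce
  \<comment> \<open>\<open>Q i\<close> visibly divides \<open>B\<close> and \<open>C\<close>, hence
    \<open>A\<close>, the only term in which \<open>Q i\<close> itself is differentiated.\<close>
  then have "A = - (B + C)"
    by (subst eq_neg_iff_add_eq_0) (simp only: add.assoc)
  moreover have "Q i dvd B" "Q i dvd C"
    by (auto simp: B_def C_def)
  ultimately have "Q i dvd A" by simp
  moreover have "inverse (gap j) - inverse (gap k) \<noteq> 0"
    using gap by simp
  ultimately have "Q i dvd pderiv (Q i) * Q j * Q k"
    by (auto simp: A_def s_def dvd_smult_iff)
  then have "Q i dvd Q j * (Q k * pderiv (Q i))"
    by (simp add: mult_ac)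
  then have "Q i dvd pderiv (Q i)"
    using Q_dvd_cancel neq by blast
  then show ?thesis by (rule pderiv_eq_0_if_dvd)
qed

lemma pderiv_eq_if_pderiv_Q_eq_0:
  assumes c: "c \<in> V" and "pderiv (Q c) = 0"
  shows "(monom 1 CARD('a) - monom 1 1) * pderiv f
    = smult (- inverse (gap c)) (\<Prod>c\<in>V. f - [:c:])"
  and "pderiv f \<noteq> 0"
proof -
  have *: "pderiv f = - smult (inverse (gap c)) cofactor"
    using pderiv_plus_cofactor[OF c] assms(2) by (simp add: eq_neg_iff_add_eq_0)
  show "(monom 1 CARD('a) - monom 1 1) * pderiv f
    = smult (- inverse (gap c)) (\<Prod>c\<in>V. f - [:c:])"
    by (simp add: * prod_diff_const)
  show "pderiv f \<noteq> 0"
    using gap_nonzero cofactor_nonzero by (simp add: *)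
qed

text \<open>If \<open>c\<close> and \<open>e\<close> were both exceptional, compare with a third
  value \<open>k\<close>: equal gaps of \<open>e\<close> and \<open>k\<close> clear
  \<open>e\<close>, different ones clear \<open>c\<close>. For two values in characteristic 2 the
  gaps \<open>c - e\<close> and \<open>e - c\<close> coincide.\<close>

lemma card_pderiv_Q_neq_0:
  assumes "card V > 2 \<or> card V = 2 \<and> CHAR('a) = 2"
  shows "2 * card {c\<in>V. pderiv (Q c) \<noteq> 0} < card V"
  using assms
proof
  assume V: "card V > 2"
  have "c = e" if "c \<in> V" "e \<in> V" "pderiv (Q c) \<noteq> 0" "pderiv (Q e) \<noteq> 0" for c e
  proof (rule ccontr)
    assume "c \<noteq> e"
    have "\<not> V \<subseteq> {c, e}"
      using V card_mono[of "{c, e}" V] \<open>c \<noteq> e\<close> by auto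
    then obtain k where "k \<in> V" "k \<noteq> c" "k \<noteq> e" by blast
    then show False
      using that \<open>c \<noteq> e\<close> pderiv_Q_eq_0_if_gap_eq[of e k] pderiv_Q_eq_0_if_gap_neq[of c e k]
      by metis
  qed
  then have "card {c\<in>V. pderiv (Q c) \<noteq> 0} \<le> 1"
    by (auto simp: card_le_Suc0_iff_eq)
  then show ?thesis using V by linarith
next
  assume *: "card V = 2 \<and> CHAR('a) = 2"
  then obtain c e where V: "V = {c, e}" "c \<noteq> e"
    by (auto simp: card_2_iff)
  have "of_nat 2 = (0::'a)"
    using * of_nat_CHAR[where 'a = 'a] by metis
  then have two: "x + x = 0" for x :: 'a
    by (metis mult_2 mult_zero_left of_nat_numeral)
  have "V - {c} = {e}" "V - {e} = {c}"
    using V by auto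
  moreover have "c - e = e - c"
    using two[of "c - e"] by (metis eq_neg_iff_add_eq_0 minus_diff_eq)
  ultimately have "gap c = gap e"
    by (simp add: gap_def)
  then have "pderiv (Q c) = 0" "pderiv (Q e) = 0"
    using pderiv_Q_eq_0_if_gap_eq[of c e] pderiv_Q_eq_0_if_gap_eq[of e c] V by auto
  then have "{c\<in>V. pderiv (Q c) \<noteq> 0} = {}"
    using V by auto
  then have "card {c\<in>V. pderiv (Q c) \<noteq> 0} = 0"
    by (simp only: card.empty)
  then show ?thesis using * by simp
qed

end

text \<open>Fewer than half of the values are exceptional for \<open>f\<close>, and likewise for \<open>g\<close>, so
  some value is good for both; the constant \<open>u\<close> is read off from its gap, which depends only
  on the value set.\<close>
lemma min_value_set_polys_common_constant:
  fixes f g :: "'a::finite_field poly"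
  assumes "min_value_set_poly f" "min_value_set_poly g" "value_set f = value_set g"
    and "card (value_set f) > 2 \<or> card (value_set f) = 2 \<and> CHAR('a) = 2"
  obtains u where
    "(monom 1 CARD('a) - monom 1 1) * pderiv f = smult u (\<Prod>c\<in>value_set f. f - [:c:])"
    "(monom 1 CARD('a) - monom 1 1) * pderiv g = smult u (\<Prod>c\<in>value_set f. g - [:c:])"
    "pderiv f \<noteq> 0"
proof -
  interpret f: min_value_set f by standard fact
  interpret g: min_value_set g by standard fact
  have gap: "g.gap = f.gap"
    by (simp add: fun_eq_iff f.gap_def g.gap_def assms(3))
  define A B where "A = {c\<in>f.V. pderiv (f.Q c) \<noteq> 0}" and "B = {c\<in>f.V. pderiv (g.Q c) \<noteq> 0}"
  have "2 * card A < card f.V" "2 * card B < card f.V"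
    using f.card_pderiv_Q_neq_0 g.card_pderiv_Q_neq_0 assms(3,4) by (auto simp: A_def B_def)
  then have "card (A \<union> B) < card f.V"
    using card_Un_le[of A B] by linarith
  then have "\<not> f.V \<subseteq> A \<union> B"
    using card_mono[of "A \<union> B" f.V] by auto
  then obtain c where c: "c \<in> f.V" "pderiv (f.Q c) = 0" "pderiv (g.Q c) = 0"
    by (auto simp: A_def B_def)
  show ?thesis
  proof (rule that)
    show "(monom 1 CARD('a) - monom 1 1) * pderiv f
        = smult (- inverse (f.gap c)) (\<Prod>c\<in>value_set f. f - [:c:])" "pderiv f \<noteq> 0"
      using f.pderiv_eq_if_pderiv_Q_eq_0 c by auto
    show "(monom 1 CARD('a) - monom 1 1) * pderiv g
        = smult (- inverse (f.gap c)) (\<Prod>c\<in>value_set f. g - [:c:])"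
      using g.pderiv_eq_if_pderiv_Q_eq_0[of c] c assms(3) by (auto simp: gap)
  qed
qed

section \<open>Curves with separated variables\<close>

lemma pderiv_eq_0_imp_pcompose_monom:
  fixes f :: "'a::idom poly"
  assumes "pderiv f = 0" "CHAR('a) > 0"
  obtains f0 where "f = pcompose f0 (monom 1 CHAR('a))"
proof
  let ?p = "CHAR('a)" and ?d = "degree f"
  \<comment> \<open>Only exponents divisible by the characteristic survive in \<open>f\<close>.
    Summing up to \<open>?d\<close> suffices, as \<open>k \<le> k * ?p\<close>.\<close>
  let ?f0 = "\<Sum>i\<le>?d. monom (coeff f (i * ?p)) i"
  have monom: "pcompose (monom c i) (monom 1 ?p) = monom c (i * ?p)" for c :: 'a and i
    by (induction i) (simp_all add: monom_0 monom_Suc pcompose_pCons mult_monom)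
  show "f = pcompose ?f0 (monom 1 ?p)"
  proof (rule poly_eqI)
    fix n
    have "coeff (pcompose ?f0 (monom 1 ?p)) n = (\<Sum>i\<le>?d. if i * ?p = n then coeff f n else 0)"
      by (auto simp: pcompose_sum monom coeff_sum intro!: sum.cong)
    also have "\<dots> = coeff f n"
    proof (cases "?p dvd n")
      case True
      then obtain k where k: "n = k * ?p" by (metis dvd_def mult.commute)
      have "(\<Sum>i\<le>?d. if i * ?p = n then coeff f n else 0) = (\<Sum>i\<le>?d. if i = k then coeff f n else 0)"
        using assms(2) by (intro sum.cong) (auto simp: k)
      also have "\<dots> = coeff f n"
      proof (cases "k \<le> ?d")
        case False
        moreover have "k \<le> n" using assms(2) by (simp add: k)
        ultimately show ?thesis by (simp add: coeff_eq_0)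
      qed simp
      finally show ?thesis .
    next
      case False
      then have "n > 0" by (auto intro: Nat.gr0I)
      then have "of_nat n * coeff f n = coeff (pderiv f) (n - 1)"
        by (simp add: coeff_pderiv)
      moreover have "of_nat n \<noteq> (0::'a)"
        using False by (simp add: of_nat_eq_0_iff_char_dvd)
      ultimately have "coeff f n = 0"
        using assms(1) by simp
      then show ?thesis by (simp cong: if_cong)
    qed
    finally show "coeff f n = coeff (pcompose ?f0 (monom 1 ?p)) n" ..
  qed
qed

text \<open>Covers two uses: \<iota> the identity and \<kappa> = \<pi> a homomorphism, or \<iota> a
  field embedding, \<kappa> the identity and \<pi> a linear retraction.\<close>

lemma map_poly_mult_linear:
  fixes \<iota> :: "'a::comm_semiring_0 \<Rightarrow> 'b::comm_semiring_0" and \<pi> :: "'b \<Rightarrow> 'c::comm_semiring_0"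
  assumes "\<iota> 0 = 0" "\<kappa> 0 = 0" "\<pi> 0 = 0" and add: "\<And>x y. \<pi> (x + y) = \<pi> x + \<pi> y"
    and "\<And>a b. \<pi> (\<iota> a * b) = \<kappa> a * \<pi> b"
  shows "map_poly \<pi> (map_poly \<iota> p * q) = map_poly \<kappa> p * map_poly \<pi> q"
proof -
  have sum: "\<pi> (sum h A) = (\<Sum>x\<in>A. \<pi> (h x))" for h and A :: "nat set"
    by (induction A rule: infinite_finite_induct) (simp_all add: assms)
  show ?thesis
    by (rule poly_eqI) (simp add: coeff_map_poly coeff_mult sum assms)
qed

lemma map_poly_mult_hom:
  fixes \<phi> :: "'a::comm_semiring_0 \<Rightarrow> 'b::comm_semiring_0"
  assumes "\<phi> 0 = 0" "\<And>x y. \<phi> (x + y) = \<phi> x + \<phi> y" "\<And>x y. \<phi> (x * y) = \<phi> x * \<phi> y"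
  shows "map_poly \<phi> (p * q) = map_poly \<phi> p * map_poly \<phi> q"
  using map_poly_mult_linear[of "\<lambda>x. x" \<phi> \<phi>] assms by simp

lemma map_poly_add_hom:
  assumes "\<phi> 0 = 0" "\<And>x y. \<phi> (x + y) = \<phi> x + \<phi> y"
  shows "map_poly \<phi> (p + q) = map_poly \<phi> p + map_poly \<phi> q"
  by (rule poly_eqI) (simp add: coeff_map_poly assms)

lemma map_poly_diff_hom:
  assumes "\<phi> 0 = 0" "\<And>x y. \<phi> (x - y) = \<phi> x - \<phi> y"
  shows "map_poly \<phi> (p - q) = map_poly \<phi> p - map_poly \<phi> q"
  by (rule poly_eqI) (simp add: coeff_map_poly assms)

section \<open>The embeddings of K[x] and K[y] into K[x,y]\<close>

lemma in_x_simps: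
  "in_x 0 = 0" "in_x (p + q) = in_x p + in_x q" "in_x (p * q) = in_x p * in_x q"
  "in_x (r - s) = in_x r - in_x s"
  for p q :: "'a::comm_semiring_1 poly" and r s :: "'b::comm_ring_1 poly"
  by (simp_all add: in_x_def mult.commute)

lemma in_y_simps:
  "in_y 0 = 0" "in_y (p + q) = in_y p + in_y q" "in_y (p * q) = in_y p * in_y q"
  "in_y (r - s) = in_y r - in_y s"
  for p q :: "'a::comm_semiring_1 poly" and r s :: "'b::comm_ring_1 poly"
  unfolding in_y_def
  by (simp_all add: map_poly_add_hom map_poly_diff_hom, subst map_poly_mult_hom) (simp_all add: mult.commute)

lemma in_y_pCons: "in_y (pCons c p) = pCons [:c:] (in_y p)"
  by (simp add: in_y_def map_poly_pCons)

lemma in_x_const: "in_x [:c:] = [:[:c:]:]" and in_y_const: "in_y [:c:] = [:[:c:]:]"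
  by (simp_all add: in_x_def in_y_def map_poly_pCons)

lemma coeff_in_y: "coeff (in_y p) n = [:coeff p n:]"
  by (simp add: in_y_def coeff_map_poly)

lemma coeff_in_x: "coeff (in_x p) n = (if n = 0 then p else 0)"
  by (simp add: in_x_def coeff_pCons split: nat.split)

lemma var_x_power: "var_x ^ n = in_x (monom 1 n)"
  by (induction n) (simp_all add: in_x_def var_x_def monom_0 monom_Suc one_pCons)

lemma var_y_power: "var_y ^ n = in_y (monom 1 n)"
proof -
  have "var_y ^ n = monom (1::'a poly) n"
    by (induction n) (simp_all add: var_y_def monom_0 monom_Suc)
  then show ?thesis
    by (simp add: in_y_def map_poly_monom one_pCons)
qed

lemma degree_in_x_diff_in_y:
  fixes f g :: "'a::comm_ring_1 poly"
  assumes "degree g > 0"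
  shows "degree (in_x f - in_y g) = degree g"
    and "coeff (in_x f - in_y g) (degree g) = [:- lead_coeff g:]"
proof -
  show c: "coeff (in_x f - in_y g) (degree g) = [:- lead_coeff g:]"
    using assms by (simp add: coeff_in_x coeff_in_y)
  show "degree (in_x f - in_y g) = degree g"
  proof (rule antisym)
    show "degree (in_x f - in_y g) \<le> degree g"
      by (rule degree_le) (use assms in \<open>auto simp: coeff_in_x coeff_in_y coeff_eq_0\<close>)
    show "degree g \<le> degree (in_x f - in_y g)"
      using c assms by (intro le_degree) auto
  qed
qed

text \<open>Its contrapositive turns the hypothesis on p-th powers into the nonvanishing of one of
  the two derivatives.\<close>

lemma in_x_diff_in_y_mem_polys_in_powers:
  fixes f g :: "'a::idom poly"
  assumes "pderiv f = 0" "pderiv g = 0" "CHAR('a) > 0"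
  shows "in_x f - in_y g \<in> polys_in_powers CHAR('a)"
proof -
  let ?m = "monom (1::'a) CHAR('a)"
  obtain f0 g0 where f0: "f = pcompose f0 ?m" and g0: "g = pcompose g0 ?m"
    using assms pderiv_eq_0_imp_pcompose_monom by metis
  have m: "monom 1 CHAR('a) = in_y ?m"
    by (simp add: in_y_def map_poly_monom one_pCons)
  have y: "pcompose (in_y h) (in_y ?m) = in_y (pcompose h ?m)" for h :: "'a poly"
    by (induction h) (simp_all add: in_y_simps in_y_const in_y_pCons pcompose_pCons)
  have "map_poly (\<lambda>c. pcompose c ?m) (in_x f0 - in_y g0) = in_x (pcompose f0 ?m) - in_y g0"
    by (rule poly_eqI) (simp add: coeff_map_poly coeff_in_x coeff_in_y pcompose_diff)
  then have "subst_powers CHAR('a) (in_x f0 - in_y g0) = in_x f - in_y g"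
    by (simp add: subst_powers_def m y pcompose_diff f0 g0 in_x_def)
  then show ?thesis
    unfolding polys_in_powers_def by (metis rangeI)
qed

section \<open>Multiples of f(x) - g(y) with separated variables\<close>

lemma base_expansion:
  fixes g B :: "'a::field poly"
  assumes "degree g > 0"
  obtains R where "poly R g = B" "\<And>i. degree (coeff R i) < degree g"
proof -
  have "\<exists>R. poly R g = B \<and> (\<forall>i. degree (coeff R i) < degree g)"
  proof (induction "degree B" arbitrary: B rule: less_induct)
    case less
    show ?case
    proof (cases "degree B < degree g")
      case True
      then show ?thesis
        using assms by (intro exI[of _ "[:B:]"]) (auto simp: coeff_pCons split: nat.split)
    next
      case False
      have "g \<noteq> 0" using assms by auto
      have "degree (B div g) < degree B"
        using False assms by (intro degree_div_less) auto
      then obtain R where R: "poly R g = B div g" "\<And>i. degree (coeff R i) < degree g"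
        using less by blast
      \<comment> \<open>The remainder is the lowest digit in base \<open>g\<close>; the quotient
        supplies the others.\<close>
      have "poly (pCons (B mod g) R) g = B"
        by (simp add: R)
      moreover have "degree (B mod g) < degree g"
        using degree_mod_less'[of g B] assms \<open>g \<noteq> 0\<close> by (cases "B mod g = 0") auto
      ultimately show ?thesis
        using R(2) by (intro exI[of _ "pCons (B mod g) R"]) (auto simp: coeff_pCons split: nat.split)
    qed
  qed
  then show ?thesis using that by blast
qed

lemma diff_dvd_poly_diff: "x - y dvd poly p x - poly p y"
  for x y :: "'a::comm_ring_1"
proof (induction p)
  case (pCons a p)
  have "poly (pCons a p) x - poly (pCons a p) y = (x - y) * poly p x + y * (poly p x - poly p y)"
    by (simp add: algebra_simps)
  then show ?case
    using pCons by simp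
qed simp

text \<open>Modulo f(x) - g(y), each g(y) in the base-\<open>g\<close> expansion of B(y) may be
  replaced by f(x). What results differs from A(x) by a multiple of f(x) - g(y) of y-degree below
  \<open>degree g\<close>, so the two are equal.\<close>

lemma separated_variables_dvd:
  fixes f g A B :: "'a::field poly"
  assumes f: "degree f > 0" and g: "degree g > 0"
    and dvd: "in_x f - in_y g dvd in_x A - in_y B"
  obtains T where "A = pcompose T f" "B = pcompose T g"
proof -
  obtain R where R: "poly R g = B" "\<And>i. degree (coeff R i) < degree g"
    using base_expansion[OF g] by blast
  define S where "S = map_poly in_y R"
  have S0: "map_poly in_y (pCons b R) = pCons (in_y b) (map_poly in_y R)" for b R
    by (simp add: map_poly_pCons in_y_simps)
  have "poly (map_poly in_y R) (in_y g) = in_y (poly R g)" for R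
    by (induction R) (simp_all add: S0 in_y_simps)
  then have Sg: "poly S (in_y g) = in_y B"
    by (simp add: S_def R(1))
  have c: "coeff (poly (map_poly in_y R) (in_x f)) k = pcompose (map_poly (\<lambda>b. coeff b k) R) f" for R k
    by (induction R) (simp_all add: S0 map_poly_pCons pcompose_pCons coeff_in_y, simp_all add: in_x_def)
  define E where "E = in_x A - poly S (in_x f)"
  have "in_x f - in_y g dvd poly S (in_x f) - poly S (in_y g)"
    by (rule diff_dvd_poly_diff)
  with dvd have "in_x f - in_y g dvd (in_x A - in_y B) - (poly S (in_x f) - poly S (in_y g))"
    by (rule dvd_diff)
  then have E_dvd: "in_x f - in_y g dvd E"
    by (simp add: E_def Sg)
  have "E = 0"
  proof (rule ccontr)
    assume "E \<noteq> 0"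
    then have deg: "degree g \<le> degree E"
      using dvd_imp_degree_le[OF E_dvd] degree_in_x_diff_in_y(1)[OF g] by simp
    have "map_poly (\<lambda>b. coeff b (degree E)) R = 0"
      using R(2) deg by (intro poly_eqI) (simp add: coeff_map_poly, meson coeff_eq_0 order.strict_trans2)
    then have "coeff E (degree E) = 0"
      using deg g by (simp add: E_def S_def c coeff_in_x)
    then show False using \<open>E \<noteq> 0\<close> by simp
  qed
  then have coeff: "coeff (in_x A) k = pcompose (map_poly (\<lambda>b. coeff b k) R) f" for k
    by (simp add: E_def S_def flip: c)
  define T where "T = map_poly (\<lambda>b. coeff b 0) R"
  \<comment> \<open>A(x) has no y^k term for k > 0, and composition with the nonconstant
    \<open>f\<close> is injective; thus all digits are constants, and they form
    \<open>T\<close>.\<close>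
  have R0: "map_poly (\<lambda>b. coeff b k) R = 0" if "k > 0" for k
    using coeff[of k] that f by (simp add: coeff_in_x pcompose_eq_0_iff)
  then have "coeff (coeff R i) k = 0" if "k > 0" for i k
    using arg_cong[OF R0[OF that], of "\<lambda>p. coeff p i"]
    by (simp add: coeff_map_poly)
  then have "R = map_poly (\<lambda>x. [:x:]) T"
    unfolding T_def by (intro poly_eqI) (auto simp: coeff_map_poly coeff_pCons split: nat.split)
  then have "B = pcompose T g"
    using R(1) by (simp add: pcompose_altdef)
  moreover have "A = pcompose T f"
    using coeff[of 0] by (simp add: coeff_in_x T_def)
  ultimately show ?thesis by (rule that[rotated])
qed

section \<open>Components over the algebraic closure\<close>

lemma partial_x_mult: "partial_x (A * B) = A * partial_x B + B * partial_x A"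
proof (rule poly_eqI)
  fix n
  have sum: "pderiv (sum h {..n}) = (\<Sum>i\<le>n. pderiv (h i))" for h :: "nat \<Rightarrow> 'a poly"
    using higher_pderiv_sum[of 1 h "{..n}"] by simp
  have "coeff (B * partial_x A) n = (\<Sum>i\<le>n. pderiv (coeff A i) * coeff B (n - i))"
    by (subst mult.commute) (simp add: coeff_mult partial_x_def coeff_map_poly)
  then show "coeff (partial_x (A * B)) n = coeff (A * partial_x B + B * partial_x A) n"
    by (simp add: partial_x_def coeff_map_poly coeff_mult sum pderiv_mult sum.distrib mult_ac)
qed

text \<open>The exponent is a parameter so that the same operator, with the order of the base field,
  also acts over the closure.\<close>

definition frobenius_derivation :: "nat \<Rightarrow> 'a::idom poly poly \<Rightarrow> 'a poly poly" where
  "frobenius_derivation q A = (var_x ^ q - var_x) * partial_x A + (var_y ^ q - var_y) * partial_y A"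

lemma frobenius_derivation_mult:
  "frobenius_derivation q (A * B) = A * frobenius_derivation q B + B * frobenius_derivation q A"
  by (simp add: frobenius_derivation_def partial_x_mult partial_y_def pderiv_mult algebra_simps)

lemma frobenius_derivation_smult:
  "frobenius_derivation q (smult [:c:] A) = smult [:c:] (frobenius_derivation q A)"
proof -
  have "partial_x (smult [:c:] A) = smult [:c:] (partial_x A)"
    by (rule poly_eqI) (simp add: partial_x_def coeff_map_poly pderiv_smult)
  then show ?thesis
    by (simp add: frobenius_derivation_def partial_y_def pderiv_smult smult_add_right)
qed

lemma pderiv_in_y: "pderiv (in_y g) = in_y (pderiv g)"
  by (rule poly_eqI) (simp add: coeff_pderiv coeff_in_y of_nat_poly mult.commute)

lemma partial_x_in_x_diff_in_y: "partial_x (in_x f - in_y g) = in_x (pderiv f)"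
  by (rule poly_eqI) (simp add: partial_x_def coeff_map_poly coeff_in_x coeff_in_y pderiv_diff)

lemma frobenius_derivation_separated:
  "frobenius_derivation q (in_x f - in_y g)
    = in_x ((monom 1 q - monom 1 1) * pderiv f) - in_y ((monom 1 q - monom 1 1) * pderiv g)"
proof -
  have "partial_y (in_x f - in_y g) = - in_y (pderiv g)"
    by (simp add: partial_y_def pderiv_diff pderiv_in_y) (simp add: in_x_def)
  moreover have "var_x ^ q - var_x = in_x (monom 1 q - monom (1::'a) 1)"
    using var_x_power[of q, where 'a = 'a] var_x_power[of 1, where 'a = 'a] by (simp add: in_x_simps)
  moreover have "var_y ^ q - var_y = in_y (monom 1 q - monom (1::'a) 1)"
    using var_y_power[of q, where 'a = 'a] var_y_power[of 1, where 'a = 'a] by (simp add: in_y_simps)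
  ultimately show ?thesis
    by (simp add: frobenius_derivation_def partial_x_in_x_diff_in_y in_x_simps in_y_simps)
qed

text \<open>Induction over prime factors: both terms of \<open>D (p * a) = p * D a + a * D p\<close>
  are divisible by \<open>p * a\<close>, even if \<open>p\<close> divides \<open>a\<close>.\<close>

lemma dvd_derivation:
  fixes D :: "'a::{factorial_semiring, idom} \<Rightarrow> 'a"
  assumes D: "\<And>a b. D (a * b) = a * D b + b * D a"
    and "\<And>p. irreducible p \<Longrightarrow> p dvd a \<Longrightarrow> p dvd D p"
  shows "a dvd D a"
  using assms(2)
proof (induction a rule: prime_divisors_induct)
  case zero
  show ?case using D[of 0 0] by simp
next
  case (unit a)
  then show ?case by (simp add: unit_imp_dvd)
next
  case (factor p a)
  have "p dvd D p"
    using factor by (simp add: prime_imp_prime_elem prime_elem_imp_irreducible)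
  moreover have "a dvd D a"
    using factor by (meson dvd_mult)
  ultimately show ?case
    by (simp add: D mult.commute[of p] mult_dvd_mono dvd_add)
qed

text \<open>Writing \<open>a = p * m\<close>, the product rule gives \<open>p dvd m * D p\<close>,
  and \<open>p\<close> does not divide \<open>m\<close> because it divides \<open>a\<close> only
  once.\<close>

lemma irreducible_dvd_derivation:
  fixes D :: "'a::{factorial_semiring, idom} \<Rightarrow> 'a"
  assumes D: "\<And>a b. D (a * b) = a * D b + b * D a"
    and p: "irreducible p" "p dvd a" "\<not> p * p dvd a" and a: "a dvd D a"
  shows "p dvd D p"
proof -
  obtain m where m: "a = p * m" using p(2) by (rule dvdE)
  have "p dvd p * D m + m * D p"
    using a p(2) by (metis D m dvd_trans)
  then have "p dvd m * D p"
    by (simp add: dvd_add_right_iff)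
  moreover have "\<not> p dvd m"
    using p(3) m by (auto intro: mult_dvd_mono)
  ultimately show ?thesis
    using p(1) by (meson irreducible_imp_prime_elem prime_elem_dvd_mult_iff)
qed

text \<open>A repeated factor divides the x-derivative f'(x), which is nonzero and free of y, so the
  factor is free of y too. It then divides every y-coefficient, including the leading one, a
  unit.\<close>

lemma not_square_dvd_separated:
  fixes f g :: "'a::field poly"
  assumes "pderiv f \<noteq> 0" "degree g > 0" "irreducible G"
  shows "\<not> G * G dvd in_x f - in_y g"
proof
  assume dvd: "G * G dvd in_x f - in_y g"
  then obtain M where M: "in_x f - in_y g = G * G * M" by (rule dvdE)
  have "G dvd partial_x (G * G * M)"
    by (simp add: partial_x_mult dvd_add mult.assoc)
  then have "G dvd in_x (pderiv f)"
    by (simp flip: M add: partial_x_in_x_diff_in_y)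
  then have "degree G = 0"
    using dvd_imp_degree_le[of G] assms(1) by (fastforce simp: in_x_def)
  then obtain c where c: "G = [:c:]" by (auto elim: degree_eq_zeroE)
  then have "[:c:] dvd in_x f - in_y g"
    using dvd by (meson dvd_mult_left)
  then have "c dvd coeff (in_x f - in_y g) (degree g)"
    by (simp only: const_poly_dvd_iff)
  then have "c dvd [:- lead_coeff g:]"
    by (simp only: degree_in_x_diff_in_y[OF assms(2)])
  moreover have "is_unit [:- lead_coeff g:]"
    using assms(2) by (auto simp: is_unit_pCons_iff)
  ultimately have "is_unit c"
    by (rule dvd_trans)
  then have "is_unit G" by (simp only: c is_unit_const_poly_iff)
  then show False using assms(3) by (simp add: irreducible_def)
qed

section \<open>Passage between the field and its closure\<close>

lemma linear_retraction_of_to_ac: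
  obtains \<pi> :: "'a::field alg_closure \<Rightarrow> 'a"
  where "\<And>x y. \<pi> (x + y) = \<pi> x + \<pi> y" "\<And>a x. \<pi> (to_ac a * x) = a * \<pi> x" "\<And>a. \<pi> (to_ac a) = a"
proof -
  let ?s = "\<lambda>a (x::'a alg_closure). to_ac a * x"
  interpret vector_space_pair "(*) :: 'a \<Rightarrow> 'a \<Rightarrow> 'a" ?s
    by unfold_locales (simp_all add: algebra_simps)
  \<comment> \<open>The closure is a vector space over the field, and an injective linear map has a
    linear left inverse.\<close>
  have "Vector_Spaces.linear (*) ?s to_ac"
    by unfold_locales (simp_all add: algebra_simps)
  then obtain \<pi> where \<pi>: "Vector_Spaces.linear ?s (*) \<pi>" "\<pi> \<circ> to_ac = id"
    using linear_injective_left_inverse inj_to_ac by blast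
  interpret \<pi>: Vector_Spaces.linear ?s "(*)" \<pi> by fact
  show ?thesis
    by (rule that[of \<pi>]) (use \<pi>(2) in \<open>auto simp: \<pi>.add \<pi>.scale fun_eq_iff\<close>)
qed

lemma map_poly_to_ac_simps:
  "map_poly to_ac (p + q) = map_poly to_ac p + map_poly to_ac q"
  "map_poly to_ac (p - q) = map_poly to_ac p - map_poly to_ac q"
  "map_poly to_ac (p * q) = map_poly to_ac p * map_poly to_ac q"
  by (simp_all add: map_poly_add_hom map_poly_diff_hom map_poly_mult_hom)

lemma to_closure_simps:
  "to_closure (p + q) = to_closure p + to_closure q"
  "to_closure (p - q) = to_closure p - to_closure q"
  "to_closure (p * q) = to_closure p * to_closure q"
  by (simp_all add: to_closure_def map_poly_to_ac_simps map_poly_add_hom map_poly_diff_hom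
      map_poly_mult_hom)

lemma to_closure_in_x: "to_closure (in_x f) = in_x (map_poly to_ac f)"
  by (simp add: to_closure_def in_x_def map_poly_pCons)

lemma to_closure_in_y: "to_closure (in_y g) = in_y (map_poly to_ac g)"
  by (rule poly_eqI) (simp add: to_closure_def coeff_in_y coeff_map_poly map_poly_pCons)

lemma pderiv_map_poly_to_ac: "pderiv (map_poly to_ac p) = map_poly to_ac (pderiv p)"
  by (rule poly_eqI) (simp add: coeff_pderiv coeff_map_poly)

lemma to_closure_frobenius_derivation:
  fixes F :: "'a::field poly poly"
  shows "to_closure (frobenius_derivation q F) = frobenius_derivation q (to_closure F)"
proof -
  have m: "map_poly to_ac (monom (1::'a) n) = monom 1 n" for n
    by (simp add: map_poly_monom)
  have "to_closure ((var_x :: 'a poly poly) ^ n) = var_x ^ n"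
    "to_closure ((var_y :: 'a poly poly) ^ n) = var_y ^ n" for n
    by (simp_all add: var_x_power var_y_power to_closure_in_x to_closure_in_y m)
  from this[of q] this[of 1]
  have "to_closure ((var_x :: 'a poly poly) ^ q - var_x) = var_x ^ q - var_x"
    "to_closure ((var_y :: 'a poly poly) ^ q - var_y) = var_y ^ q - var_y"
    by (simp_all add: to_closure_simps)
  moreover have "to_closure (partial_x F) = partial_x (to_closure F)"
    by (rule poly_eqI) (simp add: to_closure_def partial_x_def coeff_map_poly pderiv_map_poly_to_ac)
  moreover have "to_closure (partial_y F) = partial_y (to_closure F)"
  proof (rule poly_eqI)
    fix n
    have "map_poly to_ac (of_nat k * p) = of_nat k * map_poly to_ac p" for k and p :: "'a poly"
      by (rule poly_eqI) (simp add: coeff_map_poly of_nat_poly)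
    from this[of "Suc n"]
    show "coeff (to_closure (partial_y F)) n = coeff (partial_y (to_closure F)) n"
      by (simp only: to_closure_def partial_y_def coeff_pderiv coeff_map_poly map_poly_0)
  qed
  ultimately show ?thesis
    by (simp add: frobenius_derivation_def to_closure_simps)
qed

text \<open>Applying a linear retraction of \<open>to_ac\<close> to the coefficients of a quotient over the
  closure yields a quotient over the base field.\<close>
lemma to_closure_dvd_iff: "to_closure F dvd to_closure A \<longleftrightarrow> F dvd A"
proof
  assume "to_closure F dvd to_closure A"
  then obtain B where B: "to_closure A = to_closure F * B" by (rule dvdE)
  obtain \<pi> :: "'a alg_closure \<Rightarrow> 'a" where \<pi>: "\<And>x y. \<pi> (x + y) = \<pi> x + \<pi> y"
    "\<And>a x. \<pi> (to_ac a * x) = a * \<pi> x" "\<And>a. \<pi> (to_ac a) = a"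
    by (rule linear_retraction_of_to_ac) blast
  have \<pi>0: "\<pi> 0 = 0" using \<pi>(3)[of 0] by simp
  have 1: "map_poly \<pi> (map_poly to_ac p * q) = p * map_poly \<pi> q" for p q
    using map_poly_mult_linear[of to_ac "\<lambda>x. x" \<pi>] \<pi>0 \<pi> by simp
  have 2: "map_poly (map_poly \<pi>) (to_closure F * B) = F * map_poly (map_poly \<pi>) B"
    using map_poly_mult_linear[of "map_poly to_ac" "\<lambda>x. x" "map_poly \<pi>" F B] 1
    by (simp add: to_closure_def map_poly_add_hom \<pi>0 \<pi>)
  have "map_poly (map_poly \<pi>) (to_closure A) = A"
    by (intro poly_eqI) (simp add: to_closure_def coeff_map_poly \<pi>0 \<pi>)
  with 2 B show "F dvd A" by (metis dvd_triv_left)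
next
  assume "F dvd A"
  then show "to_closure F dvd to_closure A"
    by (auto simp: dvd_def to_closure_simps)
qed

text \<open>The left side of the equation vanishes on the field, so values of \<open>f\<close> are
  roots of \<open>T\<close>. The degree of \<open>T\<close> is at most the lower bound for the
  number of values, so all inequalities are equalities.\<close>

lemma min_value_set_poly_if_pderiv_eq:
  fixes f :: "'a::finite_field poly"
  assumes f: "degree f > 0" and "T \<noteq> 0"
    and T: "(monom 1 CARD('a) - monom 1 1) * pderiv (map_poly to_ac f) = pcompose T (map_poly to_ac f)"
  shows "min_value_set_poly f" "to_ac ` value_set f = {t. poly T t = 0}"
proof -
  let ?f = "map_poly to_ac f"
  have deg: "degree ?f = degree f"
    by (simp add: degree_map_poly)
  have "poly T (to_ac (poly f a)) = 0" for a
  proof -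
    have "poly ?f (to_ac a) = to_ac (poly f a)"
      by (induction f) (simp_all add: map_poly_pCons)
    moreover have "to_ac a ^ CARD('a) = to_ac a"
      by (simp add: finite_field_power_card_eq_same flip: to_ac_power)
    ultimately show ?thesis
      using arg_cong[OF T, of "\<lambda>p. poly p (to_ac a)"] by (simp add: poly_pcompose poly_monom)
  qed
  then have sub: "to_ac ` value_set f \<subseteq> {t. poly T t = 0}"
    by (auto simp: value_set_def)
  have fin: "finite {t. poly T t = 0}"
    using \<open>T \<noteq> 0\<close> by (rule poly_roots_finite)
  have card: "card (to_ac ` value_set f) = card (value_set f)"
    by (intro card_image inj_on_subset[OF inj_to_ac]) simp
  have "degree T * degree f = degree ((monom 1 CARD('a) - monom 1 1) * pderiv ?f)"
    by (simp only: T degree_pcompose deg)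
  also have "\<dots> \<le> CARD('a) + degree (pderiv ?f)"
  proof (rule order.trans[OF degree_mult_le add_right_mono])
    show "degree (monom 1 CARD('a) - monom (1::'a alg_closure) 1) \<le> CARD('a)"
      using one_less_CARD[where 'a = 'a]
      by (intro degree_diff_le degree_monom_le order.trans[OF degree_monom_le]) auto
  qed
  \<comment> \<open>The degree lost in differentiating is moved to q, so that the quotient has the
    shape of the lower bound.\<close>
  also have "\<dots> \<le> (CARD('a) - 1) + degree f"
    using degree_pderiv_less[of ?f] f one_less_CARD[where 'a = 'a] by (simp add: deg)
  finally have "degree T \<le> ((CARD('a) - 1) + degree f) div degree f"
    using f by (simp add: less_eq_div_iff_mult_less_eq)
  then have "degree T \<le> (CARD('a) - 1) div degree f + 1"
    using f by (subst (asm) div_add_self2) auto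
  then have "card {t. poly T t = 0} \<le> (CARD('a) - 1) div degree f + 1"
    using card_poly_roots_bound[OF \<open>T \<noteq> 0\<close>] by linarith
  moreover have "card (value_set f) \<le> card {t. poly T t = 0}"
    using card_mono[OF fin sub] by (simp add: card)
  moreover note value_set_lower_bound[OF f]
  ultimately have eq: "card (value_set f) = (CARD('a) - 1) div degree f + 1"
    "card {t. poly T t = 0} = card (value_set f)"
    by linarith+
  then show "min_value_set_poly f"
    using f by (simp add: min_value_set_poly_def)
  show "to_ac ` value_set f = {t. poly T t = 0}"
    using fin sub by (rule card_subset_eq) (simp add: card eq)
qed

section \<open>The two implications for the curve f(x) = g(y)\<close>

theorem corollary3p5:
  fixes f g :: "'a::finite_field poly"
  assumes "degree f > 0" and "degree g > 0"
    and "in_x f - in_y g \<notin> polys_in_powers CHAR('a)"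
    and "\<forall>G. irreducible_component (in_x f - in_y g) G \<longrightarrow> defined_over_base_field G"
  shows "((\<forall>G. irreducible_component (in_x f - in_y g) G \<longrightarrow> frobenius_nonclassical_component G)
            \<longrightarrow> min_value_set_poly f \<and> min_value_set_poly g \<and> value_set f = value_set g)
       \<and> (min_value_set_poly f \<and> min_value_set_poly g \<and> value_set f = value_set g
            \<and> (card (value_set f) > 2 \<or> card (value_set f) = 2 \<and> CHAR('a) = 2)
            \<longrightarrow> (\<forall>G. irreducible_component (in_x f - in_y g) G \<longrightarrow> frobenius_nonclassical_component G))"
proof (intro conjI impI allI)
  let ?q = "CARD('a)" and ?H = "in_x f - in_y g"
  let ?m = "map_poly to_ac :: 'a poly \<Rightarrow> _"
  have H: "to_closure ?H = in_x (?m f) - in_y (?m g)"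
    by (simp add: to_closure_simps to_closure_in_x to_closure_in_y)
  have deg: "degree (?m f) > 0" "degree (?m g) > 0"
    using assms by (simp_all add: degree_map_poly)
  {
    assume nc: "\<forall>G. irreducible_component ?H G \<longrightarrow> frobenius_nonclassical_component G"
    have "to_closure ?H dvd frobenius_derivation ?q (to_closure ?H)"
    proof (rule dvd_derivation[OF frobenius_derivation_mult])
      fix G assume "irreducible G" "G dvd to_closure ?H"
      then obtain F c where c: "c \<noteq> 0" "to_closure F = smult [:c:] G"
        and F: "F dvd frobenius_derivation ?q F"
        using nc by (auto simp: irreducible_component_def frobenius_nonclassical_component_def
            base_field_equation_def frobenius_nonclassical_def frobenius_derivation_def)
      have "to_closure F dvd frobenius_derivation ?q (to_closure F)"
        using F by (simp add: to_closure_dvd_iff flip: to_closure_frobenius_derivation)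
      then have "[:[:c:]:] * G dvd [:[:c:]:] * frobenius_derivation ?q G"
        by (simp add: c(2) frobenius_derivation_smult)
      then show "G dvd frobenius_derivation ?q G"
        using c(1) by (simp only: dvd_mult_cancel_left) auto
    qed
    then obtain T where T:
      "(monom 1 ?q - monom 1 1) * pderiv (?m f) = pcompose T (?m f)"
      "(monom 1 ?q - monom 1 1) * pderiv (?m g) = pcompose T (?m g)"
      unfolding H frobenius_derivation_separated using separated_variables_dvd deg by blast
    \<comment> \<open>One nonzero derivative suffices for both polynomials, because \<open>T\<close>
      is common to them.\<close>
    have "pderiv f \<noteq> 0 \<or> pderiv g \<noteq> 0"
      using assms(3) in_x_diff_in_y_mem_polys_in_powers[of f g] by auto
    then have nz: "pderiv (?m f) \<noteq> 0 \<or> pderiv (?m g) \<noteq> 0"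
      by (simp add: pderiv_map_poly_to_ac map_poly_eq_0_iff)
    have "coeff (monom 1 ?q - monom (1::'a alg_closure) 1) ?q = 1"
      using one_less_CARD[where 'a = 'a] by simp
    then have "monom 1 ?q - monom (1::'a alg_closure) 1 \<noteq> 0"
      by (metis coeff_0 zero_neq_one)
    with nz T have "T \<noteq> 0"
      by (metis mult_eq_0_iff pcompose_0)
    note mvsp = min_value_set_poly_if_pderiv_eq[OF assms(1) this T(1)]
      min_value_set_poly_if_pderiv_eq[OF assms(2) this T(2)]
    show "min_value_set_poly f" "min_value_set_poly g"
      by (fact mvsp)+
    show "value_set f = value_set g"
      using mvsp(2,4) inj_to_ac by (metis inj_image_eq_iff)
  }
  fix G
  assume mv: "min_value_set_poly f \<and> min_value_set_poly g \<and> value_set f = value_set g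
      \<and> (card (value_set f) > 2 \<or> card (value_set f) = 2 \<and> CHAR('a) = 2)"
    and comp: "irreducible_component ?H G"
  then have G: "irreducible G" "G dvd to_closure ?H"
    by (simp_all add: irreducible_component_def)
  obtain u where u:
    "(monom 1 ?q - monom 1 1) * pderiv f = smult u (\<Prod>c\<in>value_set f. f - [:c:])"
    "(monom 1 ?q - monom 1 1) * pderiv g = smult u (\<Prod>c\<in>value_set f. g - [:c:])"
    "pderiv f \<noteq> 0"
    using min_value_set_polys_common_constant mv by metis
  \<comment> \<open>Since \<open>u\<close> and the value set are shared, a single \<open>T\<close>
    gives the right-hand sides for both \<open>f\<close> and \<open>g\<close> by
    composition.\<close>
  define T where "T = smult u (\<Prod>c\<in>value_set f. [:- c, 1:])"
  have T: "pcompose T h = smult u (\<Prod>c\<in>value_set f. h - [:c:])" for h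
  proof -
    have "pcompose [:- c, 1:] h = h - [:c:]" for c
      by (rule poly_eqI) (simp add: pcompose_pCons coeff_pCons split: nat.split)
    then show ?thesis
      by (simp add: T_def pcompose_smult pcompose_prod)
  qed
  \<comment> \<open>Viewing the coefficients of \<open>T\<close> in K[x,y] makes T(f(x)) and T(g(y))
    two values of one polynomial, so their difference is divisible by f(x) - g(y).\<close>
  define S where "S = map_poly (\<lambda>c. [:[:c:]:]) T"
  have x: "in_x (pcompose T f) = poly S (in_x f)" and y: "in_y (pcompose T g) = poly S (in_y g)"
    unfolding S_def
    by (induction T) (simp_all add: map_poly_pCons pcompose_pCons in_x_simps in_y_simps in_x_const in_y_const)
  have "?H dvd frobenius_derivation ?q ?H"
    unfolding frobenius_derivation_separated u T[symmetric] x y by (rule diff_dvd_poly_diff)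
  then have "to_closure ?H dvd frobenius_derivation ?q (to_closure ?H)"
    by (simp add: to_closure_dvd_iff flip: to_closure_frobenius_derivation)
  moreover have "\<not> G * G dvd to_closure ?H"
    unfolding H using deg G u(3)
    by (intro not_square_dvd_separated) (simp_all add: pderiv_map_poly_to_ac map_poly_eq_0_iff)
  ultimately have D: "G dvd frobenius_derivation ?q G"
    using irreducible_dvd_derivation[of "frobenius_derivation ?q", OF frobenius_derivation_mult] G by blast
  \<comment> \<open>The equation over the base field differs from \<open>G\<close> by the constant
    \<open>c\<close>, with which D commutes; the divisibility then descends to
    \<open>F\<close>.\<close>
  obtain F c where c: "c \<noteq> 0" "to_closure F = smult [:c:] G"
    using assms(4) comp by (auto simp: defined_over_base_field_def base_field_equation_def)
  have unit: "is_unit [:[:c:]:]"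
    using c(1) by (simp add: is_unit_const_poly_iff dvd_field_iff)
  have "[:[:c:]:] * G dvd [:[:c:]:] * frobenius_derivation ?q G"
    using D by (rule mult_dvd_mono[OF dvd_refl])
  then have "to_closure F dvd frobenius_derivation ?q (to_closure F)"
    by (simp add: c(2) frobenius_derivation_smult)
  then have "F dvd frobenius_derivation ?q F"
    by (simp add: to_closure_dvd_iff flip: to_closure_frobenius_derivation)
  moreover have "irreducible (to_closure F)"
    using irreducible_mult_unit_left[OF unit, of G] G(1) by (simp add: c(2))
  ultimately show "frobenius_nonclassical_component G"
    using c unfolding frobenius_nonclassical_component_def base_field_equation_def
      frobenius_nonclassical_def frobenius_derivation_def by blast
qed

end
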